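(* Let $\Gamma\subset\mathrm{SL}_2(\mathbb{Z})$ be any torsion free subgroup. Then $\Gamma$ is a free group. *)

theory Defs
  imports "HOL-Analysis.Determinants" "HOL-Algebra.Group"
begin

definition SL2Z :: "(int^2^2) monoid" where
  "SL2Z = \<lparr>carrier = {A. det A = 1}, monoid.mult = (**), one = mat 1\<rparr>"

definition torsion_free :: "('a, 'b) monoid_scheme \<Rightarrow> bool" where
  "torsion_free G \<longleftrightarrow>
     (\<forall>x\<in>carrier G. \<forall>n::nat. n > 0 \<and> x [^]\<^bsub>G\<^esub> n = \<one>\<^bsub>G\<^esub> \<longrightarrow> x = \<one>\<^bsub>G\<^esub>)"

text \<open>
  The free group on a set \<open>S\<close> is realised by the reduced words in the letters \<open>x\<close> and \<open>x\<inverse>\<close>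
  for \<open>x \<in> S\<close>, encoded as \<open>(True, x)\<close> and \<open>(False, x)\<close>; the product of two words is their
  concatenation followed by free reduction.
\<close>

type_synonym 'a word = "(bool \<times> 'a) list"

definition inv_letter :: "bool \<times> 'a \<Rightarrow> bool \<times> 'a" where
  "inv_letter a = (\<not> fst a, snd a)"

definition reduced :: "'a word \<Rightarrow> bool" where
  "reduced w \<longleftrightarrow> successively (\<lambda>a b. b \<noteq> inv_letter a) w"

definition reduced_Cons :: "bool \<times> 'a \<Rightarrow> 'a word \<Rightarrow> 'a word" where
  "reduced_Cons a w =
     (case w of [] \<Rightarrow> [a] | b # v \<Rightarrow> if b = inv_letter a then v else a # w)"

definition free_group :: "'a set \<Rightarrow> 'a word monoid" where
  "free_group S =
     \<lparr>carrier = {w. set w \<subseteq> UNIV \<times> S \<and> reduced w},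
      monoid.mult = foldr reduced_Cons, one = []\<rparr>"

text \<open>
  Requiring the basis to have elements of the type underlying \<open>G\<close> is no restriction: the map
  \<open>x \<mapsto> [(True, x)]\<close> is injective, so a basis of \<open>G\<close> can always be identified with a subset of
  the carrier of \<open>G\<close>.
\<close>

definition is_free_group :: "('a, 'b) monoid_scheme \<Rightarrow> bool" where
  "is_free_group G \<longleftrightarrow> group G \<and> (\<exists>S::'a set. G \<cong> free_group S)"

lemma group_SL2Z: "group SL2Z"
proof (rule groupI)
  fix A assume A: "A \<in> carrier SL2Z"
  define B :: "int^2^2" where
    "B = (\<chi> i j. if i = 1 then (if j = 1 then A$2$2 else - A$1$2)
                 else (if j = 1 then - A$2$1 else A$1$1))"
  have B: "B$1$1 = A$2$2" "B$1$2 = - A$1$2" "B$2$1 = - A$2$1" "B$2$2 = A$1$1"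
    by (simp_all add: B_def)
  have "det B = 1" "B ** A = mat 1"
    using A B by (simp_all add: SL2Z_def det_2 matrix_matrix_mult_def vec_eq_iff forall_2 sum_2
        mat_def algebra_simps)
  then show "\<exists>B\<in>carrier SL2Z. B \<otimes>\<^bsub>SL2Z\<^esub> A = \<one>\<^bsub>SL2Z\<^esub>"
    by (auto simp: SL2Z_def)
qed (auto simp: SL2Z_def det_mul matrix_mul_assoc)

lemma inv_letter_inv_letter [simp]: "inv_letter (inv_letter a) = a"
  by (simp add: inv_letter_def)

lemma reduced_Cons_cancel:
  "reduced w \<Longrightarrow> reduced_Cons (inv_letter a) (reduced_Cons a w) = w"
  by (auto simp: reduced_Cons_def reduced_def split: list.splits)

lemma reduced_reduced_Cons: "reduced w \<Longrightarrow> reduced (reduced_Cons a w)"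
  by (auto simp: reduced_Cons_def reduced_def successively_Cons split: list.splits)

lemma reduced_foldr: "reduced w \<Longrightarrow> reduced (foldr reduced_Cons u w)"
  by (induction u) (auto intro: reduced_reduced_Cons)

lemma foldr_reduced_Cons:
  assumes "reduced w"
  shows "foldr reduced_Cons (reduced_Cons a v) w = reduced_Cons a (foldr reduced_Cons v w)"
proof (cases v)
  case (Cons b v')
  then show ?thesis
    using reduced_Cons_cancel[OF reduced_foldr[OF assms], of "inv_letter a"]
    by (auto simp: reduced_Cons_def)
qed (simp add: reduced_Cons_def)

lemma foldr_reduced_Cons_Nil: "reduced w \<Longrightarrow> foldr reduced_Cons w [] = w"
  by (induction w) (auto simp: reduced_Cons_def reduced_def successively_Cons split: list.splits)

lemma set_reduced_Cons: "set (reduced_Cons a w) \<subseteq> insert a (set w)"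
  by (auto simp: reduced_Cons_def split: list.splits if_splits)

lemma set_foldr_reduced_Cons: "set (foldr reduced_Cons u w) \<subseteq> set u \<union> set w"
  by (induction u) (use set_reduced_Cons in fastforce)+

lemma group_free_group: "group (free_group S)"
proof (rule groupI)
  fix u v assume "u \<in> carrier (free_group S)" "v \<in> carrier (free_group S)"
  then show "u \<otimes>\<^bsub>free_group S\<^esub> v \<in> carrier (free_group S)"
    using set_foldr_reduced_Cons[of u v] by (auto simp: free_group_def reduced_foldr)
next
  fix u v w assume "w \<in> carrier (free_group S)"
  then have w: "reduced w" by (simp add: free_group_def)
  show "u \<otimes>\<^bsub>free_group S\<^esub> v \<otimes>\<^bsub>free_group S\<^esub> w = u \<otimes>\<^bsub>free_group S\<^esub> (v \<otimes>\<^bsub>free_group S\<^esub> w)"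
    by (induction u) (simp_all add: free_group_def foldr_reduced_Cons[OF w])
next
  fix u assume u: "u \<in> carrier (free_group S)"
  let ?v = "foldr reduced_Cons (rev (map inv_letter u)) []"
  have nil: "reduced ([] :: 'a word)" by (simp add: reduced_def)
  have fold: "foldr reduced_Cons (foldr reduced_Cons x []) w = foldr reduced_Cons x w"
    if "reduced w" for x w :: "'a word"
    using that by (induction x) (auto simp: foldr_reduced_Cons)
  have "foldr reduced_Cons (rev (map inv_letter u)) (foldr reduced_Cons u []) = []"
    by (induction u) (simp_all add: reduced_Cons_cancel reduced_foldr nil)
  then have "?v \<otimes>\<^bsub>free_group S\<^esub> u = \<one>\<^bsub>free_group S\<^esub>"
    using u by (simp add: free_group_def fold foldr_reduced_Cons_Nil)
  moreover have "?v \<in> carrier (free_group S)"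
    using u set_foldr_reduced_Cons[of "rev (map inv_letter u)" "[]"]
    by (fastforce simp: free_group_def reduced_foldr nil inv_letter_def)
  ultimately show "\<exists>v\<in>carrier (free_group S). v \<otimes>\<^bsub>free_group S\<^esub> u = \<one>\<^bsub>free_group S\<^esub>" by blast
qed (auto simp: free_group_def reduced_def)

lemma free_group_extend_hom:
  assumes "group H" and f: "f \<in> S \<rightarrow> carrier H"
  shows "\<exists>h\<in>hom (free_group S) H. \<forall>x\<in>S. h [(True, x)] = f x"
proof -
  interpret H: group H by fact
  interpret F: group "free_group S" by (rule group_free_group)
  define l where "l = (\<lambda>a. if fst a then f (snd a) else inv\<^bsub>H\<^esub> (f (snd a)))"
  define h where "h = (\<lambda>w. foldr (\<lambda>a y. l a \<otimes>\<^bsub>H\<^esub> y) w \<one>\<^bsub>H\<^esub>)"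
  have l: "l a \<in> carrier H" if "a \<in> UNIV \<times> S" for a
    using that funcset_mem[OF f] by (auto simp: l_def)
  have l_inv: "l (inv_letter a) = inv\<^bsub>H\<^esub> (l a)" if "a \<in> UNIV \<times> S" for a
    using that funcset_mem[OF f] by (auto simp: l_def inv_letter_def)
  have h: "h w \<in> carrier H" if "set w \<subseteq> UNIV \<times> S" for w
    using that by (induction w) (auto simp: h_def l)
  have h_Cons: "h (reduced_Cons a w) = l a \<otimes>\<^bsub>H\<^esub> h w"
    if "a \<in> UNIV \<times> S" "set w \<subseteq> UNIV \<times> S" for a w
  proof (cases "\<exists>v. w = inv_letter a # v")
    case True
    then obtain v where v: "w = inv_letter a # v" by blast
    then have "h w = inv\<^bsub>H\<^esub> (l a) \<otimes>\<^bsub>H\<^esub> h v" using that by (simp add: h_def l_inv)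
    moreover have "h v \<in> carrier H" "l a \<in> carrier H" using that v h l by auto
    ultimately show ?thesis using v by (simp add: reduced_Cons_def flip: H.m_assoc)
  qed (auto simp: reduced_Cons_def h_def split: list.splits)
  have "h (foldr reduced_Cons u w) = h u \<otimes>\<^bsub>H\<^esub> h w"
    if "set u \<subseteq> UNIV \<times> S" "set w \<subseteq> UNIV \<times> S" for u w
    using that(1)
  proof (induction u)
    case Nil
    then show ?case using h[OF that(2)] by (simp add: h_def)
  next
    case (Cons a u)
    have "set (foldr reduced_Cons u w) \<subseteq> UNIV \<times> S"
      using set_foldr_reduced_Cons[of u w] Cons.prems that(2) by auto
    then have "h (foldr reduced_Cons (a # u) w) = l a \<otimes>\<^bsub>H\<^esub> (h u \<otimes>\<^bsub>H\<^esub> h w)"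
      using Cons h_Cons[of a "foldr reduced_Cons u w"] by auto
    moreover have "h (a # u) = l a \<otimes>\<^bsub>H\<^esub> h u" by (simp add: h_def)
    moreover have "l a \<in> carrier H" "h u \<in> carrier H" "h w \<in> carrier H"
      using Cons.prems that(2) l h by auto
    ultimately show ?case by (simp add: H.m_assoc)
  qed
  then have "h \<in> hom (free_group S) H"
    by (auto simp: hom_def free_group_def h)
  moreover have "h [(True, x)] = f x" if "x \<in> S" for x
    using funcset_mem[OF f that] by (simp add: h_def l_def)
  ultimately show "\<exists>h\<in>hom (free_group S) H. \<forall>x\<in>S. h [(True, x)] = f x" by blast
qed

lemma free_group_hom_unique:
  assumes "group H" and hk: "h \<in> hom (free_group S) H" "k \<in> hom (free_group S) H"
    and eq: "\<forall>x\<in>S. h [(True, x)] = k [(True, x)]"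
    and w: "w \<in> carrier (free_group S)"
  shows "h w = k w"
proof -
  interpret H: group H by fact
  interpret F: group "free_group S" by (rule group_free_group)
  have letter: "[a] \<in> carrier (free_group S)" if "a \<in> UNIV \<times> S" for a
    using that by (auto simp: free_group_def reduced_def)
  interpret h: group_hom "free_group S" H h by unfold_locales (fact hk)
  interpret k: group_hom "free_group S" H k by unfold_locales (fact hk)
  have eq1: "h [a] = k [a]" if a: "a \<in> UNIV \<times> S" for a
  proof (cases "fst a")
    case True
    then show ?thesis using a eq by (cases a) auto
  next
    case False
    then obtain x where x: "a = (False, x)" "x \<in> S" using a by (cases a) auto
    have "[(True, x)] \<in> carrier (free_group S)" "[a] \<in> carrier (free_group S)"
      using letter x by auto
    moreover have "[a] \<otimes>\<^bsub>free_group S\<^esub> [(True, x)] = \<one>\<^bsub>free_group S\<^esub>"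
      by (simp add: free_group_def reduced_Cons_def inv_letter_def x)
    ultimately have "[a] = inv\<^bsub>free_group S\<^esub> [(True, x)]"
      using F.inv_equality by metis
    then show ?thesis using eq x letter[of "(True, x)"] by simp
  qed
  show "h w = k w" using w
  proof (induction w)
    case Nil
    have "h \<one>\<^bsub>free_group S\<^esub> = k \<one>\<^bsub>free_group S\<^esub>" by simp
    then show ?case by (simp add: free_group_def)
  next
    case (Cons a w)
    have w: "w \<in> carrier (free_group S)" and a: "a \<in> UNIV \<times> S"
      using Cons.prems by (auto simp: free_group_def reduced_def successively_Cons)
    have "a # w = [a] \<otimes>\<^bsub>free_group S\<^esub> w"
      using Cons.prems
      by (auto simp: free_group_def reduced_def reduced_Cons_def successively_Cons split: list.splits)
    then show ?case using Cons.IH[OF w] w letter[OF a] eq1[OF a] by simp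
  qed
qed

end

theory Submission
  imports Defs "HOL-Algebra.Coset"
begin

text \<open>
  The group acts on the binary quadratic forms equivalent to \<open>x\<^sup>2 + x y + y\<^sup>2\<close>; these are the
  vertices of Conway's trivalent topograph tree, rooted at \<open>x\<^sup>2 + x y + y\<^sup>2\<close>, and all stabilisers
  are finite, so a torsion-free subgroup acts freely. A maximal subtree meeting every orbit at most
  once meets every orbit exactly once, and contracting its translates turns the tree into a tree
  with vertex set the group itself, on which the group acts by left translation. The neighbours of
  the identity in that tree, up to inversion, are a free basis: a reduced word describes a path
  without backtracking.
\<close>

section \<open>Free actions on rooted trees\<close>

text \<open>
  The edges of the tree join each vertex \<open>x \<noteq> r\<close> to its parent \<open>p x\<close>; the assumption \<open>edge\<close> says
  that the group preserves edges, but neither the root nor the direction of edges need be preserved.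
\<close>

locale rooted_tree_action = group G for G (structure) +
  fixes V :: "'v set" and act :: "'a \<Rightarrow> 'v \<Rightarrow> 'v" and r :: 'v and p :: "'v \<Rightarrow> 'v"
    and h :: "'v \<Rightarrow> nat"
  assumes act_closed: "\<lbrakk>g \<in> carrier G; x \<in> V\<rbrakk> \<Longrightarrow> act g x \<in> V"
    and act_mult: "\<lbrakk>g \<in> carrier G; k \<in> carrier G; x \<in> V\<rbrakk> \<Longrightarrow> act (g \<otimes> k) x = act g (act k x)"
    and act_one: "x \<in> V \<Longrightarrow> act \<one> x = x"
    and root: "r \<in> V"
    and parent: "\<lbrakk>x \<in> V; x \<noteq> r\<rbrakk> \<Longrightarrow> p x \<in> V"
    and height: "\<lbrakk>x \<in> V; x \<noteq> r\<rbrakk> \<Longrightarrow> h (p x) < h x"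
    and edge: "\<lbrakk>g \<in> carrier G; x \<in> V; x \<noteq> r\<rbrakk> \<Longrightarrow>
      act g x \<noteq> r \<and> p (act g x) = act g (p x) \<or> act g (p x) \<noteq> r \<and> p (act g (p x)) = act g x"
    and free: "\<lbrakk>g \<in> carrier G; x \<in> V; act g x = x\<rbrakk> \<Longrightarrow> g = \<one>"
begin

lemma act_inv:
  assumes "g \<in> carrier G" "x \<in> V"
  shows "act (inv g) (act g x) = x" "act g (act (inv g) x) = x"
  using act_mult[of "inv g" g x] act_mult[of g "inv g" x] act_one assms by auto

lemma height_induct [consumes 1, case_names root parent]:
  assumes "x \<in> V" "Q r" "\<And>x. \<lbrakk>x \<in> V; x \<noteq> r; Q (p x)\<rbrakk> \<Longrightarrow> Q x"
  shows "Q x"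
  using assms(1)
proof (induction "h x" arbitrary: x rule: less_induct)
  case less
  then show ?case using assms(2,3) parent height by (cases "x = r") blast+
qed

end

section \<open>Free bases from a tree whose vertices are the group elements\<close>

text \<open>Edges are labelled by the neighbours of \<open>\<one>\<close>. A reduced word traces a
  path from \<open>\<one>\<close> that only climbs, so \<open>\<phi>\<close> has trivial kernel, and
  descending along \<open>P\<close> spells out any element. An involution could invert an edge, and
  its letter would be its own inverse.\<close>

lemma rooted_tree_regular_action_free:
  fixes G (structure)
  assumes tree: "rooted_tree_action G (carrier G) (\<otimes>) \<one> P m"
    and two_torsion: "\<And>x. \<lbrakk>x \<in> carrier G; x \<otimes> x = \<one>\<rbrakk> \<Longrightarrow> x = \<one>"
  shows "is_free_group G"
proof -
  interpret rooted_tree_action G "carrier G" "(\<otimes>)" \<one> P m by fact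
  define A where "A = {a \<in> carrier G. a \<noteq> \<one> \<and> P a = \<one>}"
  \<comment> \<open>The edge from \<open>P k\<close> to \<open>k\<close> is translated by
    \<open>g \<otimes> inv (P k)\<close>, so that it starts at \<open>g\<close>.\<close>
  have edge_A: "g \<otimes> (inv (P k) \<otimes> k) \<noteq> \<one> \<and> P (g \<otimes> (inv (P k) \<otimes> k)) = g
      \<or> g \<noteq> \<one> \<and> P g = g \<otimes> (inv (P k) \<otimes> k)"
    if k: "k \<in> carrier G" "k \<noteq> \<one>" and g: "g \<in> carrier G" for g k
    using edge[of "g \<otimes> inv (P k)" k] parent[OF k] k g by (simp add: m_assoc)
  have edge_in_A: "inv (P k) \<otimes> k \<in> A" if k: "k \<in> carrier G" "k \<noteq> \<one>" for k
    using edge_A[OF k one_closed] k parent[OF k] by (auto simp: A_def)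
  have step: "g \<otimes> a \<noteq> \<one> \<and> P (g \<otimes> a) = g \<or> g \<noteq> \<one> \<and> P g = g \<otimes> a"
    if "a \<in> A" "g \<in> carrier G" for a g
    using edge_A[of a g] that by (auto simp: A_def)
  have inv_A: "inv a \<in> A" if "a \<in> A" for a
    using step[of a "inv a"] that by (auto simp: A_def)
  have A_neq: "inv a \<noteq> a" if "a \<in> A" for a
    using two_torsion[of a] that r_inv[of a] by (metis (mono_tags, lifting) A_def mem_Collect_eq)
  \<comment> \<open>\<open>pick\<close> sees only the set \<open>{a, inv a}\<close>, so
    \<open>a\<close> and \<open>inv a\<close> make the same choice and \<open>S\<close> keeps
    exactly one of each pair.\<close>
  define pick where "pick X = (SOME x. x \<in> X)" for X :: "'a set"
  have pick: "pick {a, inv a} \<in> {a, inv a}" for a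
    unfolding pick_def by (rule someI[of _ a]) simp
  define S where "S = {a \<in> A. pick {a, inv a} = a}"
  have S_A: "S \<subseteq> A" by (auto simp: S_def)
  have A_carrier: "A \<subseteq> carrier G" by (auto simp: A_def)
  have pick_inv: "pick {inv a, inv (inv a)} = pick {a, inv a}" if "a \<in> A" for a
  proof -
    have "{inv a, inv (inv a)} = {a, inv a}" using that A_carrier by auto
    then show ?thesis by simp
  qed
  have S_total: "a \<in> S \<or> inv a \<in> S" if "a \<in> A" for a
    using pick[of a] that pick_inv[OF that] inv_A[OF that] by (auto simp: S_def)
  have S_excl: "inv a \<notin> S" if "a \<in> S" for a
    using that pick_inv[of a] A_neq[of a] S_A by (auto simp: S_def)
  interpret F: group "free_group S" by (rule group_free_group)
  obtain \<phi> where \<phi>: "\<phi> \<in> hom (free_group S) G" "\<forall>x\<in>S. \<phi> [(True, x)] = x"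
    using free_group_extend_hom[of G "\<lambda>x. x" S] S_A A_carrier is_group by auto
  interpret \<phi>: group_hom "free_group S" G \<phi> by unfold_locales (fact \<phi>)
  define l where "l a = (if fst a then snd a else inv (snd a))" for a :: "bool \<times> 'a"
  have letter: "[a] \<in> carrier (free_group S)" if "a \<in> UNIV \<times> S" for a
    using that by (auto simp: free_group_def reduced_def)
  have l: "\<phi> [a] = l a" if a: "a \<in> UNIV \<times> S" for a
  proof (cases "fst a")
    case True
    then show ?thesis using a \<phi>(2) by (cases a) (auto simp: l_def)
  next
    case False
    then obtain x where x: "a = (False, x)" "x \<in> S" using a by (cases a) auto
    have "[a] \<otimes>\<^bsub>free_group S\<^esub> [(True, x)] = \<one>\<^bsub>free_group S\<^esub>"
      by (simp add: free_group_def reduced_Cons_def inv_letter_def x)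
    then have "[a] = inv\<^bsub>free_group S\<^esub> [(True, x)]"
      using F.inv_equality letter x by (metis UNIV_I mem_Sigma_iff)
    then show ?thesis using \<phi>(2) x letter[of "(True, x)"] by (simp add: l_def)
  qed
  have l_A: "l a \<in> A" if "a \<in> UNIV \<times> S" for a
    using that S_A inv_A by (auto simp: l_def)
  have l_cancel: "b = inv_letter a"
    if ab: "a \<in> UNIV \<times> S" "b \<in> UNIV \<times> S" and eq: "l a \<otimes> l b = \<one>" for a b
  proof -
    obtain s x t y where [simp]: "a = (s, x)" "b = (t, y)" by (cases a, cases b)
    have xy: "x \<in> S" "y \<in> S" "x \<in> carrier G" "y \<in> carrier G" using ab S_A A_carrier by auto
    have "l b = inv (l a)"
      using eq l_A[OF ab(1)] l_A[OF ab(2)] A_carrier by (metis inv_equality inv_inv subsetD)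
    then have "s \<noteq> t \<and> inv x = inv y"
      using xy S_excl[of x] S_excl[of y] by (cases s; cases t) (simp_all add: l_def)
    then have "s \<noteq> t" "inv (inv x) = inv (inv y)" by simp_all
    then show ?thesis using xy by (simp add: inv_letter_def)
  qed
  have \<phi>_Cons: "\<phi> (a # w) = l a \<otimes> \<phi> w" "w \<in> carrier (free_group S)" "a \<in> UNIV \<times> S"
    if aw: "a # w \<in> carrier (free_group S)" for a w
  proof -
    show w: "w \<in> carrier (free_group S)" and a: "a \<in> UNIV \<times> S"
      using aw by (auto simp: free_group_def reduced_def successively_Cons)
    have "a # w = [a] \<otimes>\<^bsub>free_group S\<^esub> w"
      using aw
      by (auto simp: free_group_def reduced_def reduced_Cons_def successively_Cons split: list.splits)
    then show "\<phi> (a # w) = l a \<otimes> \<phi> w" using w letter[OF a] l[OF a] by simp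
  qed
  \<comment> \<open>The last premise says that the first step does not go down, so by
    \<open>step\<close> it goes up to a child of \<open>g\<close>. Reducedness keeps the next letter
    from undoing it, which restores the premise.\<close>
  have path: "m g < m (g \<otimes> \<phi> (a # w))"
    if "a # w \<in> carrier (free_group S)" "g \<in> carrier G" "g = \<one> \<or> P g \<noteq> g \<otimes> l a" for a w g
    using that
  proof (induction w arbitrary: a g)
    case Nil
    have "l a \<in> A" using l_A \<phi>_Cons(3) Nil by blast
    then have "g \<otimes> l a \<noteq> \<one> \<and> P (g \<otimes> l a) = g" using step Nil by blast
    then show ?case
      using height[of "g \<otimes> l a"] l \<phi>_Cons(3)[OF Nil(1)] \<open>l a \<in> A\<close> A_carrier Nil by auto
  next
    case (Cons b w)
    note a = Cons.prems(1) and bw = \<phi>_Cons(2)[OF Cons.prems(1)]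
    have lA: "l a \<in> A" "l b \<in> A" using l_A \<phi>_Cons(3) a bw by blast+
    have lc: "l a \<in> carrier G" "l b \<in> carrier G" using lA A_carrier by auto
    have 1: "g \<otimes> l a \<noteq> \<one> \<and> P (g \<otimes> l a) = g" using step lA Cons.prems by blast
    then have 2: "m g < m (g \<otimes> l a)" using height[of "g \<otimes> l a"] lc Cons.prems by auto
    have "b \<noteq> inv_letter a" using a by (simp add: free_group_def reduced_def)
    then have "l a \<otimes> l b \<noteq> \<one>" using l_cancel \<phi>_Cons(3) a bw by blast
    then have "P (g \<otimes> l a) \<noteq> g \<otimes> l a \<otimes> l b"
      using 1 lc Cons.prems by (simp add: m_assoc)
    then have "m (g \<otimes> l a) < m (g \<otimes> l a \<otimes> \<phi> (b # w))"
      using Cons.IH[OF bw] lc Cons.prems by blast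
    then show ?case
      using 2 \<phi>_Cons(1)[OF a] lc bw Cons.prems by (simp add: m_assoc)
  qed
  have ker: "w = []" if "w \<in> carrier (free_group S)" "\<phi> w = \<one>" for w
    using path[of "hd w" "tl w" \<one>] that by (cases w) auto
  have "g \<in> \<phi> ` carrier (free_group S)" if "g \<in> carrier G" for g
    using that
  proof (induction g rule: height_induct)
    case root
    show ?case using \<phi>.hom_one F.one_closed by (metis image_eqI)
  next
    case (parent k)
    then obtain w where w: "w \<in> carrier (free_group S)" "P k = \<phi> w" by blast
    \<comment> \<open>The label of the edge from \<open>P k\<close> to \<open>k\<close> prolongs the
      word for \<open>P k\<close>.\<close>
    let ?a = "inv (P k) \<otimes> k"
    have a: "?a \<in> A" using edge_in_A parent by blast
    obtain b where b: "b \<in> UNIV \<times> S" "l b = ?a"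
    proof (cases "?a \<in> S")
      case True
      then show thesis using that[of "(True, ?a)"] by (simp add: l_def)
    next
      case False
      then show thesis
        using that[of "(False, inv ?a)"] S_total[OF a] a A_carrier inv_inv
        by (auto simp: l_def simp del: inv_mult_group)
    qed
    have "k = P k \<otimes> ?a" using parent w by (simp flip: m_assoc)
    also have "\<dots> = \<phi> (w \<otimes>\<^bsub>free_group S\<^esub> [b])" using w b letter l by simp
    finally show ?case using w letter b by (metis F.m_closed image_eqI)
  qed
  then have "\<phi> \<in> iso (free_group S) G"
    unfolding \<phi>.iso_iff using ker by (auto simp: free_group_def)
  then have "G \<cong> free_group S" using F.iso_sym is_isoI by blast
  then show ?thesis using is_group by (auto simp: is_free_group_def)
qed

section \<open>Fundamental subtrees and the contraction of their translates\<close>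

context rooted_tree_action
begin

text \<open>Maximality forces the subtree to meet every orbit, as every vertex is joined to the root.\<close>

lemma fundamental_subtree:
  obtains T where "T \<subseteq> V" "r \<in> T" "\<And>t. \<lbrakk>t \<in> T; t \<noteq> r\<rbrakk> \<Longrightarrow> p t \<in> T"
    "\<And>g t. \<lbrakk>g \<in> carrier G; t \<in> T; act g t \<in> T\<rbrakk> \<Longrightarrow> g = \<one>"
    "\<And>v. v \<in> V \<Longrightarrow> \<exists>g\<in>carrier G. \<exists>t\<in>T. v = act g t"
proof -
  \<comment> \<open>Closure under \<open>p\<close> makes a subtree through \<open>r\<close>; by
    freeness, the last clause amounts to meeting each orbit at most once.\<close>
  define \<T> where "\<T> = {T. T \<subseteq> V \<and> r \<in> T \<and> (\<forall>t\<in>T. t \<noteq> r \<longrightarrow> p t \<in> T) \<and>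
    (\<forall>g\<in>carrier G. \<forall>t\<in>T. act g t \<in> T \<longrightarrow> g = \<one>)}"
  have "{r} \<in> \<T>" using root free by (auto simp: \<T>_def)
  then have nonempty: "\<T> \<noteq> {}" by blast
  have chain: "\<Union>C \<in> \<T>" if C: "C \<noteq> {}" "subset.chain \<T> C" for C
  proof -
    have CT: "C \<subseteq> \<T>" using C by (auto simp: subset.chain_def)
    have "g = \<one>" if g: "g \<in> carrier G" and t: "t \<in> \<Union>C" "act g t \<in> \<Union>C" for g t
    proof -
      obtain X Y where XY: "X \<in> C" "t \<in> X" "Y \<in> C" "act g t \<in> Y" using t by blast
      then have "X \<subseteq> Y \<or> Y \<subseteq> X" using C by (auto simp: subset.chain_def)
      then obtain Z where "Z \<in> C" "t \<in> Z" "act g t \<in> Z" using XY by blast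
      then show ?thesis using CT g by (auto simp: \<T>_def)
    qed
    moreover have "\<Union>C \<subseteq> V" "r \<in> \<Union>C" "\<forall>t\<in>\<Union>C. t \<noteq> r \<longrightarrow> p t \<in> \<Union>C"
      using CT C by (auto simp: \<T>_def)
    ultimately show ?thesis unfolding \<T>_def by blast
  qed
  obtain T where "T \<in> \<T>" and max: "\<And>X. \<lbrakk>X \<in> \<T>; T \<subseteq> X\<rbrakk> \<Longrightarrow> X = T"
    using subset_Zorn_nonempty[OF nonempty chain] by auto
  then have T: "T \<subseteq> V" "r \<in> T" "\<And>t. \<lbrakk>t \<in> T; t \<noteq> r\<rbrakk> \<Longrightarrow> p t \<in> T"
    "\<And>g t. \<lbrakk>g \<in> carrier G; t \<in> T; act g t \<in> T\<rbrakk> \<Longrightarrow> g = \<one>"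
    unfolding \<T>_def by blast+
  have "\<exists>g\<in>carrier G. \<exists>t\<in>T. v = act g t" if "v \<in> V" for v
    using that
  proof (induction v rule: height_induct)
    case root
    have "r = act \<one> r" using T(1,2) act_one[of r] by auto
    then show ?case using T(2) one_closed by blast
  next
    case (parent v)
    obtain g t where g: "g \<in> carrier G" "t \<in> T" "p v = act g t" using parent.IH by blast
    \<comment> \<open>Pulling back by \<open>g\<close> puts \<open>w\<close> next to
      \<open>t\<close>. As the parent of \<open>t\<close> it lies in \<open>T\<close>; as a child it
      could be added to \<open>T\<close> if its orbit missed \<open>T\<close>.\<close>
    define w where "w = act (inv g) v"
    have t: "t \<in> V" using g T by blast
    have w: "w \<in> V" "v = act g w" using act_closed act_inv g parent by (auto simp: w_def)
    have pv: "act (inv g) (p v) = t" using g act_inv t by simp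
    from edge[of "inv g" v] consider "w \<noteq> r" "p w = t" | "t \<noteq> r" "p t = w"
      using parent g pv by (auto simp: w_def)
    then show ?case
    proof cases
      case 2
      then show ?thesis using T(3) g w by metis
    next
      case 1
      show ?thesis
      proof (rule ccontr)
        assume no: "\<not> ?thesis"
        have orbit: "act k s \<noteq> w" if "k \<in> carrier G" "s \<in> T" for k s
        proof
          assume "act k s = w"
          then have "v = act (g \<otimes> k) s" using w act_mult g that T by auto
          then show False using no that g by blast
        qed
        have orbit': "act k w \<notin> T" if k: "k \<in> carrier G" for k
          using orbit[of "inv k" "act k w"] act_inv(1)[OF k w(1)] k by auto
        have "k = \<one>" if "k \<in> carrier G" "s \<in> insert w T" "act k s \<in> insert w T" for k s
          using that orbit[of k s] orbit'[of k] free[of k w] w(1) T(4)[of k s] by auto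
        then have "insert w T \<in> \<T>" using T 1 g(2) w(1) by (auto simp: \<T>_def)
        then have "w \<in> T" using max by blast
        then show False using orbit[of \<one> w] w(1) act_one by simp
      qed
    qed
  qed
  then show ?thesis using that T by blast
qed

text \<open>The translates of \<open>T\<close> partition \<open>V\<close>, and ranking them by their
  lowest vertices roots the contracted tree. Freeness on vertices alone would let an involution swap
  the ends of an edge, hence \<open>two_torsion\<close>.\<close>

theorem free_group_of_free_action:
  assumes two_torsion: "\<And>x. \<lbrakk>x \<in> carrier G; x \<otimes> x = \<one>\<rbrakk> \<Longrightarrow> x = \<one>"
  shows "is_free_group G"
proof -
  obtain T where T: "T \<subseteq> V" "r \<in> T" "\<And>t. \<lbrakk>t \<in> T; t \<noteq> r\<rbrakk> \<Longrightarrow> p t \<in> T"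
    and T_free: "\<And>g t. \<lbrakk>g \<in> carrier G; t \<in> T; act g t \<in> T\<rbrakk> \<Longrightarrow> g = \<one>"
    and T_cover: "\<And>v. v \<in> V \<Longrightarrow> \<exists>g\<in>carrier G. \<exists>t\<in>T. v = act g t"
    using fundamental_subtree by blast
  define tile where "tile g = act g ` T" for g
  have tile_V: "tile g \<subseteq> V" if "g \<in> carrier G" for g
    using that T act_closed by (auto simp: tile_def)
  have tile_one: "tile \<one> = T" using T act_one by (force simp: tile_def)
  have tile_mult: "act g x \<in> tile (g \<otimes> k)"
    if gk: "g \<in> carrier G" "k \<in> carrier G" and x: "x \<in> tile k" for g k x
  proof -
    obtain t where t: "t \<in> T" "x = act k t" using x by (auto simp: tile_def)
    then have "act g x = act (g \<otimes> k) t" using act_mult[OF gk] T(1) by auto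
    then show ?thesis using t(1) by (auto simp: tile_def)
  qed
  have tile_unique: "g = k"
    if gk: "g \<in> carrier G" "k \<in> carrier G" and x: "x \<in> tile g" "x \<in> tile k" for g k x
  proof -
    have "act (inv g) x \<in> T" using tile_mult[of "inv g" g x] gk x tile_one by simp
    moreover obtain t where t: "t \<in> T" "x = act k t" using x by (auto simp: tile_def)
    moreover have "act (inv g) x = act (inv g \<otimes> k) t" using act_mult gk t T by auto
    ultimately have "inv g \<otimes> k = \<one>" using T_free[of "inv g \<otimes> k" t] gk by simp
    then show ?thesis using gk by (metis inv_closed inv_equality inv_inv)
  qed
  have tile_exists: "\<exists>g\<in>carrier G. v \<in> tile g" if "v \<in> V" for v
    using T_cover[OF that] by (auto simp: tile_def)
  \<comment> \<open>For \<open>g \<noteq> \<one>\<close> the parent of this lowest vertex is lower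
    still, hence in another tile, which becomes the parent of \<open>g\<close>.\<close>
  define top where "top g = arg_min h (\<lambda>v. v \<in> tile g)" for g
  have top: "top g \<in> tile g" "\<And>v. v \<in> tile g \<Longrightarrow> h (top g) \<le> h v" for g
  proof -
    have "act g r \<in> tile g" using T by (auto simp: tile_def)
    then show "top g \<in> tile g" "\<And>v. v \<in> tile g \<Longrightarrow> h (top g) \<le> h v"
      unfolding top_def by (auto intro: arg_min_natI arg_min_nat_le)
  qed
  have top_r: "top g \<noteq> r" if "g \<in> carrier G" "g \<noteq> \<one>" for g
    using tile_unique[of g \<one> r] top(1)[of g] tile_one T(2) that by auto
  define P where "P g = (THE k. k \<in> carrier G \<and> p (top g) \<in> tile k)" for g
  have P: "P g = k" if "k \<in> carrier G" "p (top g) \<in> tile k" for g k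
    unfolding P_def using that tile_unique by blast
  have P_carrier: "P g \<in> carrier G" and P_tile: "p (top g) \<in> tile (P g)"
    and P_height: "h (top (P g)) < h (top g)" if g: "g \<in> carrier G" "g \<noteq> \<one>" for g
  proof -
    have V: "top g \<in> V" using g top(1) tile_V by blast
    then obtain k where k: "k \<in> carrier G" "p (top g) \<in> tile k"
      using tile_exists parent top_r[OF g] by blast
    then show "P g \<in> carrier G" "p (top g) \<in> tile (P g)" using P[OF k] by auto
    then show "h (top (P g)) < h (top g)"
      using top(2) height[OF V top_r[OF g]] by (meson le_less_trans)
  qed
  text \<open>A tile is connected, hence entered from the root through one edge only.\<close>
  have entry: "x = top g"
    if g: "g \<in> carrier G" "g \<noteq> \<one>" and x: "x \<in> tile g" "p x \<notin> tile g" for g x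
  proof -
    define R where "R = {(y, p y) | y. y \<in> tile g \<and> p y \<in> tile g}"
    \<comment> \<open>\<open>D\<close> collects the vertices that descend to \<open>top g\<close>
      inside the tile. Translation may reverse edges, so membership in \<open>D\<close> is shown to
      be constant along the edges of \<open>T\<close>; hence \<open>D\<close> is the whole
      tile.\<close>
    define D where "D = {y. (y, top g) \<in> R\<^sup>*}"
    have top_p: "p (top g) \<notin> tile g"
      using top(2)[of "p (top g)" g] height[OF _ top_r[OF g]] top(1)[of g] tile_V[OF g(1)]
      by fastforce
    have D_cases: "y = top g \<or> p y \<in> tile g \<and> p y \<in> D" if "y \<in> D" for y
      using that unfolding D_def by (auto simp: R_def elim: converse_rtranclE)
    have D_child: "y \<in> D" if "p y \<in> D" "y \<in> tile g" "p y \<in> tile g" for y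
      using that unfolding D_def by (auto simp: R_def intro: converse_rtrancl_into_rtrancl)
    have D_parent: "p y \<in> D" if "y \<in> D" "p y \<in> tile g" for y
      using D_cases[OF that(1)] that(2) top_p by auto
    have root_iff: "act g t \<in> D \<longleftrightarrow> act g r \<in> D" if "t \<in> T" for t
    proof -
      have "t \<in> V" using that T by auto
      then have "t \<in> T \<longrightarrow> (act g t \<in> D \<longleftrightarrow> act g r \<in> D)"
      proof (induction t rule: height_induct)
        case (parent t)
        show ?case
        proof
          assume t: "t \<in> T"
          then have tiles: "act g t \<in> tile g" "act g (p t) \<in> tile g"
            using T(3) parent by (auto simp: tile_def)
          have "act g t \<in> D \<longleftrightarrow> act g (p t) \<in> D"
            using edge[OF g(1) parent(1,2)] tiles D_child D_parent by metis
          then show "act g t \<in> D \<longleftrightarrow> act g r \<in> D" using parent t T(3) by blast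
        qed
      qed simp
      then show ?thesis using that by blast
    qed
    have "top g \<in> D" by (simp add: D_def)
    then have "x \<in> D" using root_iff top(1)[of g] x(1) by (auto simp: tile_def)
    then show ?thesis using D_cases x(2) by blast
  qed
  \<comment> \<open>An edge between two tiles leaves the upper one at its lowest vertex, so it is
    the edge that defines \<open>P\<close>.\<close>
  have cross: "k \<noteq> \<one> \<and> P k = j"
    if kj: "k \<in> carrier G" "j \<in> carrier G" "j \<noteq> k" and x: "x \<in> tile k" "x \<noteq> r" "p x \<in> tile j"
    for k j x
  proof -
    have out: "p x \<notin> tile k" using tile_unique kj x by blast
    then have "k \<noteq> \<one>" using T(3) x tile_one by auto
    moreover from this have "x = top k" using entry kj x out by blast
    ultimately show ?thesis using P kj x by blast
  qed
  have "rooted_tree_action G (carrier G) (\<otimes>) \<one> P (\<lambda>g. h (top g))"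
  proof unfold_locales
    fix g k assume gk: "g \<in> carrier G" "k \<in> carrier G" "k \<noteq> \<one>"
    have tiles: "act g (top k) \<in> tile (g \<otimes> k)" "act g (p (top k)) \<in> tile (g \<otimes> P k)"
      using tile_mult top(1) P_tile P_carrier gk by auto
    have "P k \<noteq> k" using P_height[OF gk(2,3)] by auto
    then have "g \<otimes> P k \<noteq> g \<otimes> k" using gk P_carrier by simp
    then have neq: "g \<otimes> P k \<noteq> g \<otimes> k" "g \<otimes> k \<noteq> g \<otimes> P k" by auto
    have closed: "g \<otimes> k \<in> carrier G" "g \<otimes> P k \<in> carrier G" using gk P_carrier by auto
    have "top k \<in> V" using top(1) tile_V gk by blast
    \<comment> \<open>The translated edge still joins two distinct tiles, in one direction or the
      other.\<close>
    from edge[OF gk(1) this top_r[OF gk(2,3)]]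
    show "g \<otimes> k \<noteq> \<one> \<and> P (g \<otimes> k) = g \<otimes> P k \<or> g \<otimes> P k \<noteq> \<one> \<and> P (g \<otimes> P k) = g \<otimes> k"
    proof (elim disjE conjE)
      assume "act g (top k) \<noteq> r" "p (act g (top k)) = act g (p (top k))"
      then show ?thesis using cross[OF closed neq(1) tiles(1)] tiles(2) by simp
    next
      assume "act g (p (top k)) \<noteq> r" "p (act g (p (top k))) = act g (top k)"
      then show ?thesis using cross[OF closed(2,1) neq(2) tiles(2)] tiles(1) by simp
    qed
  qed (use P_carrier P_height in \<open>auto simp: m_assoc\<close>)
  then show ?thesis using two_torsion by (rule rooted_tree_regular_action_free)
qed

end

section \<open>The tree of quadratic forms of discriminant \<open>-3\<close>\<close>

text \<open>
  The triple \<open>(a, b, c)\<close> stands for the form \<open>a x\<^sup>2 + b x y + c y\<^sup>2\<close>, on which a matrix acts by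
  \<open>M \<mapsto> g M g\<^sup>T\<close> for the Gram matrix \<open>M\<close>. The invariant pairing polarises the negative of the
  discriminant; two forms equivalent to \<open>(1, 1, 1)\<close> are adjacent if their pairing is \<open>5\<close>.
\<close>

type_synonym form = "int \<times> int \<times> int"

definition form_act :: "int^2^2 \<Rightarrow> form \<Rightarrow> form" where
  "form_act g = (\<lambda>(a, b, c).
     (a * (g$1$1)^2 + b * g$1$1 * g$1$2 + c * (g$1$2)^2,
      2 * a * g$1$1 * g$2$1 + b * (g$1$1 * g$2$2 + g$1$2 * g$2$1) + 2 * c * g$1$2 * g$2$2,
      a * (g$2$1)^2 + b * g$2$1 * g$2$2 + c * (g$2$2)^2))"

definition pairing :: "form \<Rightarrow> form \<Rightarrow> int" where
  "pairing = (\<lambda>(a, b, c) (a', b', c'). 2 * (a * c' + a' * c) - b * b')"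

abbreviation root_form :: form where "root_form \<equiv> (1, 1, 1)"

definition forms :: "form set" where
  "forms = {form_act g root_form | g. det g = 1}"

abbreviation form_height :: "form \<Rightarrow> int" where "form_height \<equiv> pairing root_form"

section \<open>Invariance of the pairing and the neighbours of the root form\<close>

lemma form_act_mult: "form_act (g ** k) x = form_act g (form_act k x)"
  by (cases x)
    (simp add: form_act_def matrix_matrix_mult_def sum_2 power2_eq_square algebra_simps)

lemma form_act_one: "form_act (mat 1) x = x"
  by (cases x) (simp add: form_act_def mat_def)

lemma pairing_commute: "pairing x y = pairing y x"
  by (cases x; cases y) (simp add: pairing_def)

lemma pairing_act:
  assumes "det g = 1"
  shows "pairing (form_act g x) (form_act g y) = pairing x y"
proof -
  obtain a b c a' b' c' where xy: "x = (a, b, c)" "y = (a', b', c')" by (cases x, cases y)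
  have "pairing (form_act g x) (form_act g y) = (det g)^2 * pairing x y"
    unfolding xy pairing_def form_act_def det_2 by (simp, algebra)
  then show ?thesis using assms by simp
qed

lemma forms_act: "\<lbrakk>det g = 1; x \<in> forms\<rbrakk> \<Longrightarrow> form_act g x \<in> forms"
  unfolding forms_def by clarify (metis det_mul form_act_mult mult_1)

lemma root_form: "root_form \<in> forms"
  unfolding forms_def using form_act_one[of root_form] by (force intro: exI[of _ "mat 1"])

lemma pairing_self: "x \<in> forms \<Longrightarrow> pairing x x = 3"
  unfolding forms_def using pairing_act[of _ root_form root_form] by (auto simp: pairing_def)

text \<open>Eliminating \<open>b\<close> leaves an ellipse in \<open>a\<close> and \<open>c\<close>;
  completing the square in either variable confines both to the range from 1 to 3.\<close>

lemma root_neighbours: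
  assumes "pairing N N = 3" "pairing root_form N = 5"
  shows "N \<in> {(1, -1, 1), (1, 3, 3), (3, 3, 1)}"
proof -
  obtain a b c where N: "N = (a, b, c)" by (cases N)
  have b: "b = 2 * (a + c) - 5" and disc: "4 * a * c - b^2 = 3"
    using assms by (auto simp: N pairing_def power2_eq_square algebra_simps)
  have "4 * (a^2 + a * c + c^2 - 5 * (a + c) + 7) = 0"
    using disc unfolding b by (simp add: power2_eq_square algebra_simps)
  then have eq: "a^2 + a * c + c^2 - 5 * (a + c) + 7 = 0" by simp
  have "3 * (2 * a + c - 5)^2 + (3 * c - 5)^2 = 16" using eq by algebra
  moreover have "3 * (2 * c + a - 5)^2 + (3 * a - 5)^2 = 16" using eq by algebra
  ultimately have "(3 * c - 5)^2 \<le> 16" "(3 * a - 5)^2 \<le> 16"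
    using zero_le_power2[of "2 * a + c - 5"] zero_le_power2[of "2 * c + a - 5"]
    by linarith+
  then have "\<bar>3 * c - 5\<bar> \<le> 4" "\<bar>3 * a - 5\<bar> \<le> 4"
    by (simp_all flip: abs_le_square_iff[of _ 4, simplified])
  then have "1 \<le> a \<and> a \<le> 3" "1 \<le> c \<and> c \<le> 3" by (simp_all add: abs_le_iff)
  then have "a = 1 \<or> a = 2 \<or> a = 3" "c = 1 \<or> c = 2 \<or> c = 3" by presburger+
  then show ?thesis using eq unfolding N b by (elim disjE) simp_all
qed

lemma root_neighbours_forms: "{(1, -1, 1), (1, 3, 3), (3, 3, 1)} \<subseteq> forms"
proof -
  have *: "form_act (vector [vector [p, q], vector [r, s]]) root_form \<in> forms"
    if "p * s - q * r = 1" for p q r s :: int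
    using that by (auto simp: forms_def det_2)
  show ?thesis
    \<comment> \<open>The arguments fill \<open>p\<close>, \<open>s\<close>, \<open>q\<close>,
      \<open>r\<close> in this order: a quarter turn and the two elementary matrices.\<close>
    using *[of 0 0 "-1" 1] *[of 1 1 0 1] *[of 1 1 1 0]
    by (simp add: form_act_def)
qed

section \<open>Heights of the three neighbours of a form\<close>

text \<open>
  In the application \<open>x\<close>, \<open>y\<close>, \<open>z\<close> are half the changes of height from a vertex to its three
  neighbours, so the lemma says that exactly one neighbour of a vertex other than the root is lower.
\<close>

lemma three_numbers:
  fixes x y z a b c :: int
  assumes "x * y + y * z + z * x = 3" "x + y = 2 * a" "y + z = 2 * b" "z + x = 2 * c"
    and "a > 0" "b > 0" "c > 0"
  shows "x = 1 \<and> y = 1 \<and> z = 1 \<or> x < 0 \<and> y > 0 \<and> z > 0 \<or> x > 0 \<and> y < 0 \<and> z > 0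
    \<or> x > 0 \<and> y > 0 \<and> z < 0"
proof -
  \<comment> \<open>If \<open>u = 0\<close>, then \<open>v\<close> and \<open>w\<close> are even
    with product 3.\<close>
  have no_zero: "u \<noteq> 0"
    if "u * v + v * w + w * u = 3" "u + v = 2 * i" "w + u = 2 * j" for u v w i j :: int
  proof
    assume "u = 0"
    then have "4 * (i * j) = 3" using that by (simp add: algebra_simps)
    then show False by presburger
  qed
  have cyclic: "y * z + z * x + x * y = 3" "z * x + x * y + y * z = 3" using assms(1) by simp_all
  have nz: "x \<noteq> 0" "y \<noteq> 0" "z \<noteq> 0"
    using no_zero[OF assms(1,2,4)] no_zero[OF cyclic(1) assms(3,2)] no_zero[OF cyclic(2) assms(4,3)]
    by blast+
  have one: "x = 1 \<and> y = 1 \<and> z = 1" if "x > 0" "y > 0" "z > 0"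
  proof -
    have "(x - 1) * (y - 1) \<ge> 0" "(y - 1) * (z - 1) \<ge> 0" "(z - 1) * (x - 1) \<ge> 0"
      using that by auto
    then have "2 * (x + y + z) \<le> 6" using assms(1) by (simp add: algebra_simps)
    then show ?thesis using that by auto
  qed
  \<comment> \<open>Positive pairwise sums allow at most one negative number.\<close>
  have sums: "x + y > 0" "y + z > 0" "z + x > 0" using assms by auto
  consider "x > 0" "y > 0" "z > 0" | "x < 0" | "y < 0" | "z < 0" using nz by linarith
  then show ?thesis using sums one by cases auto
qed

lemma form_sum_pos:
  fixes x y :: int
  assumes "x \<noteq> 0 \<or> y \<noteq> 0"
  shows "x^2 - x * y + y^2 > 0"
proof -
  have "2 * (x^2 - x * y + y^2) = x^2 + y^2 + (x - y)^2" by algebra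
  moreover have "x^2 + y^2 > 0" using assms by (simp add: sum_power2_gt_zero_iff)
  ultimately have "2 * (x^2 - x * y + y^2) > 0" by (simp only: add_pos_nonneg zero_le_power2)
  then show ?thesis using zero_less_mult_pos by fastforce
qed

text \<open>\<open>a\<close>, \<open>b\<close>, \<open>c\<close> are the values of x^2 - x y + y^2
  at the two columns of \<open>g\<close> and at their sum. They make the heights of a form and of
  its neighbours directly comparable.\<close>

lemma form_height_act:
  assumes "p = g$1$1" "q = g$1$2" "r = g$2$1" "s = g$2$2"
    and a: "a = p^2 - p * r + r^2" and b: "b = q^2 - q * s + s^2"
    and c: "c = (p + q)^2 - (p + q) * (r + s) + (r + s)^2"
  shows "form_height (form_act g (i, j, k)) = 2 * i * a + j * (c - a - b) + 2 * k * b"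
  unfolding a b c by (simp add: form_act_def pairing_def flip: assms(1-4)) algebra

text \<open>An inverse of \<open>g\<close> moves \<open>M\<close> to the root, where
  \<open>root_neighbours\<close> lists the candidates; the changes of height then satisfy
  \<open>three_numbers\<close>.\<close>

lemma form_neighbours:
  assumes M: "M \<in> forms"
  obtains N\<^sub>1 N\<^sub>2 N\<^sub>3 x y z where "{N. N \<in> forms \<and> pairing M N = 5} = {N\<^sub>1, N\<^sub>2, N\<^sub>3}"
    "form_height N\<^sub>1 = form_height M + 2 * x" "form_height N\<^sub>2 = form_height M + 2 * y"
    "form_height N\<^sub>3 = form_height M + 2 * z"
    "x = 1 \<and> y = 1 \<and> z = 1 \<and> form_height M = 3 \<or> x < 0 \<and> y > 0 \<and> z > 0
      \<or> x > 0 \<and> y < 0 \<and> z > 0 \<or> x > 0 \<and> y > 0 \<and> z < 0"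
    "form_height M \<ge> 3"
proof -
  obtain g where g: "det g = 1" "M = form_act g root_form" using M by (auto simp: forms_def)
  obtain k where k: "det k = 1" "g ** k = mat 1"
    using group.r_inv_ex[OF group_SL2Z, of g] g by (auto simp: SL2Z_def)
  let ?R = "{(1, -1, 1), (1, 3, 3), (3, 3, 1)}"
  have "form_act k N \<in> ?R" if "N \<in> forms" "pairing M N = 5" for N
  proof (rule root_neighbours)
    show "pairing (form_act k N) (form_act k N) = 3"
      using pairing_self that(1) pairing_act k(1) by simp
    show "pairing root_form (form_act k N) = 5"
      using pairing_act[OF g(1), of root_form "form_act k N"] that(2) g(2) k(2)
        form_act_mult[of g k N] form_act_one[of N] by simp
  qed
  then have sub: "N \<in> form_act g ` ?R" if "N \<in> forms" "pairing M N = 5" for N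
    using that k(2) form_act_mult[of g k N] form_act_one[of N] by (metis image_eqI)
  have sup: "form_act g N \<in> forms \<and> pairing M (form_act g N) = 5" if "N \<in> ?R" for N
  proof -
    have "form_act g N \<in> forms" using forms_act g(1) root_neighbours_forms that by blast
    moreover have "pairing root_form N = 5" using that by (auto simp: pairing_def)
    ultimately show ?thesis using pairing_act g by simp
  qed
  have nbrs: "{N. N \<in> forms \<and> pairing M N = 5}
      = {form_act g (1, -1, 1), form_act g (1, 3, 3), form_act g (3, 3, 1)}"
    using sub sup by auto
  obtain p q r s where pqrs: "p = g$1$1" "q = g$1$2" "r = g$2$1" "s = g$2$2" by blast
  have det: "p * s - q * r = 1" using g(1) by (simp add: det_2 pqrs)
  define a b c where "a = p^2 - p * r + r^2" and "b = q^2 - q * s + s^2"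
    and "c = (p + q)^2 - (p + q) * (r + s) + (r + s)^2"
  have "(p \<noteq> 0 \<or> r \<noteq> 0) \<and> (q \<noteq> 0 \<or> s \<noteq> 0) \<and> (p + q \<noteq> 0 \<or> r + s \<noteq> 0)"
  proof -
    have "p * (r + s) - r * (p + q) = 1" using det by (simp add: algebra_simps)
    then show ?thesis using det by auto
  qed
  then have pos: "a > 0" "b > 0" "c > 0" unfolding a_def b_def c_def by (simp_all add: form_sum_pos)
  note height = form_height_act[OF pqrs a_def b_def c_def]
  have h: "form_height M = a + b + c" unfolding g(2) height by simp
  define x y z where "x = a + b - c" and "y = b + c - a" and "z = c + a - b"
  \<comment> \<open>This is Heron's formula for a triangle with squared sides \<open>a\<close>,
    \<open>b\<close>, \<open>c\<close>; determinant 1 makes the value 3.\<close>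
  have "x * y + y * z + z * x = 3 * (p * s - q * r)^2"
    unfolding x_def y_def z_def a_def b_def c_def by algebra
  then have "x = 1 \<and> y = 1 \<and> z = 1 \<or> x < 0 \<and> y > 0 \<and> z > 0 \<or> x > 0 \<and> y < 0 \<and> z > 0
    \<or> x > 0 \<and> y > 0 \<and> z < 0"
    using three_numbers[of x y z b c a] det pos by (simp add: x_def y_def z_def)
  moreover have "form_height M = 3" if "x = 1 \<and> y = 1 \<and> z = 1"
    using that h unfolding x_def y_def z_def by linarith
  moreover have "form_height (form_act g (1, -1, 1)) = form_height M + 2 * x"
    "form_height (form_act g (1, 3, 3)) = form_height M + 2 * y"
    "form_height (form_act g (3, 3, 1)) = form_height M + 2 * z"
    unfolding h height x_def y_def z_def by simp_all
  moreover have "form_height M \<ge> 3" using h pos by linarith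
  ultimately show ?thesis using that[OF nbrs] by blast
qed

section \<open>Unique lower neighbours\<close>

text \<open>Eliminating \<open>b\<close> turns the discriminant condition into a vanishing sum of
  three squares.\<close>

lemma form_height_root:
  assumes "M \<in> forms" "form_height M = 3"
  shows "M = root_form"
proof -
  obtain a b c where M: "M = (a, b, c)" by (cases M)
  have b: "b = 2 * (a + c) - 3" and disc: "4 * a * c - b^2 = 3"
    using assms pairing_self[of M] by (auto simp: M pairing_def power2_eq_square algebra_simps)
  have "2 * ((a - 1)^2 + (c - 1)^2 + (a + c - 2)^2) = 0"
    using disc unfolding b by (simp add: power2_eq_square algebra_simps)
  then have "(a - 1)^2 + (c - 1)^2 + (a + c - 2)^2 = 0" by simp
  then have "(a - 1)^2 = 0" "(c - 1)^2 = 0"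
    by (simp_all add: add_nonneg_eq_0_iff)
  then show ?thesis using b by (simp add: M)
qed

lemma form_height_ge: "M \<in> forms \<Longrightarrow> form_height M \<ge> 3"
  by (elim form_neighbours)

text \<open>No change of height is zero, so every edge, wherever a translation carries it, has a
  definite lower end.\<close>

lemma form_height_neq:
  assumes "M \<in> forms" "N \<in> forms" "pairing M N = 5"
  shows "form_height M \<noteq> form_height N"
proof -
  obtain N\<^sub>1 N\<^sub>2 N\<^sub>3 x y z where N: "{N. N \<in> forms \<and> pairing M N = 5} = {N\<^sub>1, N\<^sub>2, N\<^sub>3}"
    and *: "form_height N\<^sub>1 = form_height M + 2 * x" "form_height N\<^sub>2 = form_height M + 2 * y"
    "form_height N\<^sub>3 = form_height M + 2 * z"
    "x = 1 \<and> y = 1 \<and> z = 1 \<and> form_height M = 3 \<or> x < 0 \<and> y > 0 \<and> z > 0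
      \<or> x > 0 \<and> y < 0 \<and> z > 0 \<or> x > 0 \<and> y > 0 \<and> z < 0"
    by (rule form_neighbours[OF assms(1)])
  have "N \<in> {N. N \<in> forms \<and> pairing M N = 5}" using assms by simp
  then have "N = N\<^sub>1 \<or> N = N\<^sub>2 \<or> N = N\<^sub>3" unfolding N by simp
  moreover have "x \<noteq> 0" "y \<noteq> 0" "z \<noteq> 0" using *(4) by auto
  ultimately show ?thesis using *(1-3) by (elim disjE) simp_all
qed

definition form_parent :: "form \<Rightarrow> form" where
  "form_parent M = (THE N. N \<in> forms \<and> pairing M N = 5 \<and> form_height N < form_height M)"

text \<open>Height 3 occurs only at the root, so the case of three changes equal to 1 drops out; in
  every other case exactly one is negative.\<close>

lemma form_parent_ex1:
  assumes "M \<in> forms" "M \<noteq> root_form"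
  shows "\<exists>!N. N \<in> forms \<and> pairing M N = 5 \<and> form_height N < form_height M"
proof -
  have h: "form_height M \<noteq> 3" using form_height_root assms by blast
  obtain N\<^sub>1 N\<^sub>2 N\<^sub>3 x y z where N: "{N. N \<in> forms \<and> pairing M N = 5} = {N\<^sub>1, N\<^sub>2, N\<^sub>3}"
    and *: "form_height N\<^sub>1 = form_height M + 2 * x" "form_height N\<^sub>2 = form_height M + 2 * y"
    "form_height N\<^sub>3 = form_height M + 2 * z"
    "x = 1 \<and> y = 1 \<and> z = 1 \<and> form_height M = 3 \<or> x < 0 \<and> y > 0 \<and> z > 0
      \<or> x > 0 \<and> y < 0 \<and> z > 0 \<or> x > 0 \<and> y > 0 \<and> z < 0"
    by (rule form_neighbours[OF assms(1)])
  have nbr: "N \<in> forms \<and> pairing M N = 5 \<longleftrightarrow> N = N\<^sub>1 \<or> N = N\<^sub>2 \<or> N = N\<^sub>3" for N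
    using N by (metis (mono_tags, lifting) insert_iff mem_Collect_eq empty_iff)
  have lower: "N \<in> forms \<and> pairing M N = 5 \<and> form_height N < form_height M \<longleftrightarrow>
      (N = N\<^sub>1 \<and> x < 0 \<or> N = N\<^sub>2 \<and> y < 0 \<or> N = N\<^sub>3 \<and> z < 0)" for N
    unfolding conj_assoc[symmetric] nbr using *(1-3) by auto
  from *(4) h consider "x < 0" "\<not> y < 0" "\<not> z < 0" | "\<not> x < 0" "y < 0" "\<not> z < 0"
    | "\<not> x < 0" "\<not> y < 0" "z < 0" by linarith
  then show ?thesis unfolding lower by cases simp_all
qed

lemma form_parent:
  assumes "M \<in> forms" "M \<noteq> root_form"
  shows "form_parent M \<in> forms" "pairing M (form_parent M) = 5"
    "form_height (form_parent M) < form_height M"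
  using theI'[OF form_parent_ex1[OF assms]] unfolding form_parent_def by auto

lemma form_parent_eqI:
  assumes "M \<in> forms" "N \<in> forms" "pairing M N = 5" "form_height N < form_height M"
  shows "M \<noteq> root_form \<and> form_parent M = N"
proof -
  have "M \<noteq> root_form"
    using form_height_ge[OF assms(2)] assms(4) by (auto simp: pairing_def)
  then show ?thesis
    using the1_equality[OF form_parent_ex1] assms by (simp add: form_parent_def)
qed

section \<open>Stabilisers of forms consist of torsion elements\<close>

lemma (in group) nat_pow_conj_eq_one:
  assumes x: "x \<in> carrier G" and g: "g \<in> carrier G" "y \<in> carrier G" "y \<otimes> g = \<one>"
    and pow: "(y \<otimes> (x \<otimes> g)) [^] (n::nat) = \<one>"
  shows "x [^] n = \<one>"
proof -
  have y: "y = inv g" using inv_equality[OF g(3,1,2)] by simp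
  define j where "j = y \<otimes> (x \<otimes> g)"
  have j: "j \<in> carrier G" using x g by (simp add: j_def)
  have conj: "x \<otimes> g = g \<otimes> j" using x g y by (simp add: j_def flip: m_assoc)
  have "x [^] m \<otimes> g = g \<otimes> j [^] m" for m :: nat
  proof (induction m)
    case (Suc m)
    have "x [^] Suc m \<otimes> g = x [^] m \<otimes> (g \<otimes> j)" using g x conj by (simp add: m_assoc)
    also have "\<dots> = x [^] m \<otimes> g \<otimes> j" using g x j by (simp add: m_assoc)
    finally show ?case using Suc g j by (simp add: m_assoc)
  qed (use g in simp)
  then have "x [^] n \<otimes> g = g" using pow g by (simp add: j_def)
  then show ?thesis using g x by (simp add: r_cancel_one')
qed

text \<open>The stabiliser of \<open>x\<^sup>2 + x y + y\<^sup>2\<close> is the group of units of the Eisenstein integers.\<close>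

lemma root_form_stabiliser:
  assumes det: "det k = 1" and fixed: "form_act k root_form = root_form"
  shows "k [^]\<^bsub>SL2Z\<^esub> (6::nat) = \<one>\<^bsub>SL2Z\<^esub>"
proof -
  obtain p q r s where pqrs: "k$1$1 = p" "k$1$2 = q" "k$2$1 = r" "k$2$2 = s" by blast
  have 1: "p^2 + p * q + q^2 = 1" and 2: "p * s - q * r = 1"
    and 3: "2 * p * r + (p * s + q * r) + 2 * q * s = 1"
    using det fixed by (simp_all add: det_2 pqrs form_act_def)
  have "2 * (p * r + p * s + q * s) = 2 * 1" "2 * (p * r + q * r + q * s) = 0"
    using 2 3 by (simp_all add: algebra_simps)
  then have "p * r + p * s + q * s = 1" "p * r + q * r + q * s = 0" by simp_all
  then have rs: "r = - q" "s = p + q" using 1 by algebra+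
  \<comment> \<open>Now \<open>k\<close> is \<open>p + q w\<close>, where \<open>w\<close> has rows
    (0, 1) and (-1, 1) and is a primitive sixth root of unity. Its norm
    \<open>p^2 + p * q + q^2\<close> is 1, which leaves finitely many cases.\<close>
  have "(2 * p + q)^2 + 3 * q^2 = 4" "(2 * q + p)^2 + 3 * p^2 = 4" using 1 by algebra+
  then have "p^2 \<le> 1" "q^2 \<le> 1" using zero_le_power2[of "2 * p + q"] zero_le_power2[of "2 * q + p"]
    by linarith+
  then have "\<bar>p\<bar> \<le> 1" "\<bar>q\<bar> \<le> 1" by (simp_all add: abs_square_le_1)
  then have "p \<in> {-1, 0, 1}" "q \<in> {-1, 0, 1}" by auto
  then have pq: "(p, q) \<in> {(1, 0), (-1, 0), (0, 1), (0, -1), (1, -1), (-1, 1)}"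
    using 1 by auto
  have "k ** k ** k ** k ** k ** k = mat 1"
    using pq by (auto simp: matrix_matrix_mult_def vec_eq_iff forall_2 sum_2 mat_def pqrs rs)
  then show ?thesis by (simp add: SL2Z_def numeral_eq_Suc)
qed

text \<open>Conjugating by a matrix that takes \<open>root_form\<close> to \<open>x\<close> reduces
  this to the stabiliser of \<open>root_form\<close>.\<close>

lemma form_stabiliser:
  assumes k: "k \<in> carrier SL2Z" and x: "x \<in> forms" and fixed: "form_act k x = x"
  shows "k [^]\<^bsub>SL2Z\<^esub> (6::nat) = \<one>\<^bsub>SL2Z\<^esub>"
proof -
  obtain g where g: "det g = 1" "x = form_act g root_form" using x by (auto simp: forms_def)
  obtain g' where g': "det g' = 1" "g' ** g = mat 1"
    using group.l_inv_ex[OF group_SL2Z, of g] g by (auto simp: SL2Z_def)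
  have "det (g' ** (k ** g)) = 1" using g g' k by (simp add: det_mul SL2Z_def)
  moreover have "form_act (g' ** (k ** g)) root_form = root_form"
    using fixed[unfolded g(2)] form_act_mult[of g' g root_form] g'(2)
    by (simp add: form_act_mult form_act_one)
  ultimately have "(g' ** (k ** g)) [^]\<^bsub>SL2Z\<^esub> (6::nat) = \<one>\<^bsub>SL2Z\<^esub>"
    by (rule root_form_stabiliser)
  then show ?thesis
    using group.nat_pow_conj_eq_one[OF group_SL2Z k, of g g'] g g' by (simp add: SL2Z_def)
qed

section \<open>The action on the tree and its restriction to torsion-free subgroups\<close>

text \<open>Translation keeps adjacency but may alter heights; whichever image is lower is the
  parent of the other.\<close>

lemma form_edge:
  assumes g: "det g = 1" and M: "M \<in> forms" "M \<noteq> root_form"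
  shows "form_act g M \<noteq> root_form \<and> form_parent (form_act g M) = form_act g (form_parent M)
    \<or> form_act g (form_parent M) \<noteq> root_form
      \<and> form_parent (form_act g (form_parent M)) = form_act g M"
proof -
  let ?M = "form_act g M" and ?N = "form_act g (form_parent M)"
  have forms: "?M \<in> forms" "?N \<in> forms" using forms_act[OF g] M form_parent(1)[OF M] by blast+
  have adj: "pairing ?M ?N = 5" "pairing ?N ?M = 5"
    using pairing_act[OF g] form_parent(2)[OF M] pairing_commute by metis+
  from form_height_neq[OF forms adj(1)] consider
    "form_height ?N < form_height ?M" | "form_height ?M < form_height ?N" by linarith
  then show ?thesis using form_parent_eqI forms adj by cases blast+
qed

interpretation SL2Z: group SL2Z by (rule group_SL2Z)

theorem theorem10:
  fixes \<Gamma> :: "(int^2^2) set"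
  assumes "subgroup \<Gamma> SL2Z"
    and "torsion_free (SL2Z\<lparr>carrier := \<Gamma>\<rparr>)"
  shows "is_free_group (SL2Z\<lparr>carrier := \<Gamma>\<rparr>)"
proof -
  let ?G = "SL2Z\<lparr>carrier := \<Gamma>\<rparr>"
  interpret group ?G using assms(1) group_SL2Z by (rule subgroup.subgroup_is_group)
  have \<Gamma>: "g \<in> carrier SL2Z" "det g = 1" if "g \<in> \<Gamma>" for g
    using that subgroup.subset[OF assms(1)] by (auto simp: SL2Z_def)
  have torsion: "g = \<one>\<^bsub>?G\<^esub>" if "g \<in> \<Gamma>" "g [^]\<^bsub>?G\<^esub> n = \<one>\<^bsub>?G\<^esub>" "n > 0" for g and n :: nat
    using assms(2) that by (auto simp: torsion_free_def)
  have tree: "rooted_tree_action ?G forms form_act root_form form_parent (\<lambda>M. nat (form_height M))"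
  proof unfold_locales
    fix g k M assume "g \<in> carrier ?G" "M \<in> forms"
    then show "form_act g M \<in> forms" using forms_act \<Gamma> by simp
  next
    fix M assume M: "M \<in> forms" "M \<noteq> root_form"
    then show "form_parent M \<in> forms" by (rule form_parent)
    show "nat (form_height (form_parent M)) < nat (form_height M)"
      \<comment> \<open>Heights are at least 3, so \<open>nat\<close> preserves the strict
        inequality.\<close>
      using form_parent(3)[OF M] form_height_ge[OF M(1)] by linarith
  next
    fix g M assume "g \<in> carrier ?G" "M \<in> forms" "M \<noteq> root_form"
    then show "form_act g M \<noteq> root_form \<and> form_parent (form_act g M) = form_act g (form_parent M)
      \<or> form_act g (form_parent M) \<noteq> root_form
        \<and> form_parent (form_act g (form_parent M)) = form_act g M"
      using form_edge \<Gamma> by simp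
  next
    fix g M assume "g \<in> carrier ?G" "M \<in> forms" "form_act g M = M"
    \<comment> \<open>The sixth power of a stabilising element is trivial, so torsion-freeness
      leaves only the identity.\<close>
    then have "g [^]\<^bsub>SL2Z\<^esub> (6::nat) = \<one>\<^bsub>SL2Z\<^esub>" "g \<in> \<Gamma>" using form_stabiliser \<Gamma> by simp_all
    then show "g = \<one>\<^bsub>?G\<^esub>" using torsion[of g 6] SL2Z.nat_pow_consistent[of g 6 \<Gamma>] by simp
  qed (use root_form form_act_mult form_act_one in \<open>simp_all add: SL2Z_def\<close>)
  have "x = \<one>\<^bsub>?G\<^esub>" if "x \<in> carrier ?G" "x \<otimes>\<^bsub>?G\<^esub> x = \<one>\<^bsub>?G\<^esub>" for x
    using torsion[of x 2] \<Gamma>(1)[of x] that by (simp add: numeral_2_eq_2)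
  with tree show ?thesis by (rule rooted_tree_action.free_group_of_free_action)
qed

end
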